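(* Let $\mathbb{Q}$ be the space of rational numbers and let $e:\mathbb{Q}\to\mathbb{R}^{C(\mathbb{Q})}$ be the diagonal embedding. Then, with $\mathbb{Q}$ identified with $e[\mathbb{Q}]$, the product $\mathbb{Q}\times\mathbb{Q}$ is not $C^*$-embedded in $\mathbb{R}^{C(\mathbb{Q})}\times\mathbb{R}^{C(\mathbb{Q})}$; that is, $e[\mathbb{Q}]\times e[\mathbb{Q}]$ is not $C^*$-embedded in $\mathbb{R}^{C(\mathbb{Q})}\times\mathbb{R}^{C(\mathbb{Q})}$.
   Context: $\mathbb{Q}$ carries its usual topology as a subspace of $\mathbb{R}$. For a space $X$, $C(X)$ is the set of all continuous functions $X\to\mathbb{R}$, $\mathbb{R}^{C(X)}$ carries the product topology, and the diagonal embedding $e:X\to\mathbb{R}^{C(X)}$ is defined by $e(x)=\langle f(x):f\in C(X)\rangle$. A subspace $A$ of a space $Y$ is $C^*$-embedded in $Y$ if every bounded continuous function from $A$ to $\mathbb{R}$ admits a continuous extension to $Y$. *)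

theory Defs
  imports "HOL-Analysis.Analysis"
begin

text \<open>The set C(X) of all continuous real-valued functions on X. Functions are taken to be
  extensional, so that each continuous function on the space X is counted exactly once.\<close>

definition continuous_real_functions :: "'a topology \<Rightarrow> ('a \<Rightarrow> real) set" where
  "continuous_real_functions X =
     {f \<in> extensional (topspace X). continuous_map X euclideanreal f}"

definition real_power_topology :: "'a topology \<Rightarrow> (('a \<Rightarrow> real) \<Rightarrow> real) topology" where
  "real_power_topology X =
     product_topology (\<lambda>f. euclideanreal) (continuous_real_functions X)"

definition diagonal_embedding :: "'a topology \<Rightarrow> 'a \<Rightarrow> ('a \<Rightarrow> real) \<Rightarrow> real" where
  "diagonal_embedding X x = (\<lambda>f\<in>continuous_real_functions X. f x)"

text \<open>Only meant for subsets A of the underlying set of Y.\<close>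

definition Cstar_embedded :: "'a topology \<Rightarrow> 'a set \<Rightarrow> bool" where
  "Cstar_embedded Y A \<longleftrightarrow>
     (\<forall>g. continuous_map (subtopology Y A) euclideanreal g \<and> bounded (g ` A) \<longrightarrow>
          (\<exists>h. continuous_map Y euclideanreal h \<and> (\<forall>a\<in>A. h a = g a)))"

lemma diagonal_embedding_image_subset:
  "diagonal_embedding X ` S \<subseteq> topspace (real_power_topology X)"
  by (auto simp: diagonal_embedding_def real_power_topology_def)

text \<open>The rationals with the subspace topology inherited from the real line.\<close>

abbreviation rational_space :: "real topology" where
  "rational_space \<equiv> top_of_set \<rat>"

end

theory Submission imports Defs
begin

text \<open>
  Fix an irrational \<open>c\<close> and let \<open>g (x, y) = 1\<close> if \<open>y - x > c\<close> and \<open>g (x, y) = 0\<close> otherwise. The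
  difference of two rationals is never \<open>c\<close>, so \<open>g\<close> is continuous on \<open>\<rat> \<times> \<rat>\<close>; but it has a jump at
  every point of the line \<open>y = x + c\<close>. The transported function on \<open>e[\<rat>] \<times> e[\<rat>]\<close> is bounded and
  continuous, and it has no continuous extension \<open>h\<close> to the product of the two powers.

  At a single point, \<open>h\<close> is determined by countably many coordinates
  (\<open>continuous_map_countably_determined_at\<close>). As \<open>\<rat>\<close> is countable, there is one countable
  set \<open>A\<close> of continuous functions on \<open>\<rat>\<close> that serves for all points of \<open>e[\<rat>] \<times> e[\<rat>]\<close> at once: \<open>h\<close>
  does not notice if all coordinates of \<open>e x\<close> and \<open>e y\<close> outside \<open>A\<close> are replaced by \<open>0\<close>. Write
  \<open>r x\<close> for \<open>e x\<close> changed in this way, so that \<open>h (r x, r y) = g (x, y)\<close>.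

  The real numbers at which a given continuous function on \<open>\<rat>\<close> has oscillation zero form a dense
  \<open>G\<^sub>\<delta>\<close> set, so Baire's theorem yields a \<open>t\<close> such that every member of \<open>A\<close> has oscillation zero
  both at \<open>t\<close> and at \<open>t + c\<close> (\<open>common_zero_oscillation_point\<close>). If rationals \<open>x\<^sub>n\<close> tend to \<open>t\<close> and
  rationals \<open>y\<^sub>n\<close> tend to \<open>t + c\<close>, then \<open>r x\<^sub>n\<close> and \<open>r y\<^sub>n\<close> converge in the power, because every
  coordinate in \<open>A\<close> does and all others are constant. Hence \<open>g (x\<^sub>n, y\<^sub>n) = h (r x\<^sub>n, r y\<^sub>n)\<close>
  converges. But \<open>x\<^sub>n\<close> and \<open>y\<^sub>n\<close> can be chosen so that \<open>y\<^sub>n - x\<^sub>n\<close> lies alternately above and below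
  \<open>c\<close>, and then \<open>g (x\<^sub>n, y\<^sub>n)\<close> alternates between \<open>1\<close> and \<open>0\<close>.
\<close>

section \<open>Continuous functions on products depend on few coordinates at a point\<close>

lemma open_contains_finite_coordinate_agreement:
  assumes "openin (product_topology X I) U" "p \<in> U"
  shows "\<exists>F. finite F \<and> (\<forall>w\<in>topspace (product_topology X I). (\<forall>i\<in>F. w i = p i) \<longrightarrow> w \<in> U)"
proof -
  obtain V where V: "p \<in> Pi\<^sub>E I V" "\<And>i. openin (X i) (V i)"
      "finite {i. V i \<noteq> topspace (X i)}" "Pi\<^sub>E I V \<subseteq> U"
    using product_topology_open_contains_basis[OF assms] by blast
  have "w \<in> U" if "w \<in> topspace (product_topology X I)" "\<forall>i\<in>{i. V i \<noteq> topspace (X i)}. w i = p i" for w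
  proof -
    have "w i \<in> V i" if "i \<in> I" for i
      using that \<open>w \<in> topspace _\<close> \<open>\<forall>i\<in>_. w i = p i\<close> V(1)
      by (cases "V i = topspace (X i)") (auto simp: PiE_iff)
    then have "w \<in> Pi\<^sub>E I V"
      using \<open>w \<in> topspace _\<close> by (auto simp: PiE_iff)
    then show ?thesis
      using V(4) by blast
  qed
  then show ?thesis
    using V(3) by blast
qed

text \<open>
  A singleton in a metric space is the intersection of countably many balls, and each of their
  preimages contains every point that agrees with the given one on some finite set of coordinates.
\<close>

lemma continuous_map_countably_determined_at:
  fixes h :: "_ \<Rightarrow> 'm::metric_space"
  assumes h: "continuous_map (prod_topology (product_topology X I) (product_topology Y J)) euclidean h"
    and p: "p \<in> topspace (product_topology X I)" and q: "q \<in> topspace (product_topology Y J)"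
  shows "\<exists>A B. countable A \<and> countable B \<and>
    (\<forall>v\<in>topspace (product_topology X I). \<forall>w\<in>topspace (product_topology Y J).
       (\<forall>i\<in>A. v i = p i) \<longrightarrow> (\<forall>j\<in>B. w j = q j) \<longrightarrow> h (v, w) = h (p, q))"
proof -
  let ?P = "product_topology X I" and ?Q = "product_topology Y J"
  define R where "R n F G \<longleftrightarrow> finite F \<and> finite G \<and> (\<forall>v\<in>topspace ?P. \<forall>w\<in>topspace ?Q.
      (\<forall>i\<in>F. v i = p i) \<longrightarrow> (\<forall>j\<in>G. w j = q j) \<longrightarrow> dist (h (p, q)) (h (v, w)) < 1 / Suc n)"
    for n :: nat and F G
  have "\<exists>F G. R n F G" for n
  proof -
    let ?W = "{z \<in> topspace (prod_topology ?P ?Q). h z \<in> ball (h (p, q)) (1 / Suc n)}"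
    have "openin (prod_topology ?P ?Q) ?W"
      by (rule openin_continuous_map_preimage[OF h]) (simp flip: open_openin)
    moreover have "(p, q) \<in> ?W"
      using p q by simp
    ultimately obtain U V where UV: "openin ?P U" "openin ?Q V" "p \<in> U" "q \<in> V" "U \<times> V \<subseteq> ?W"
      unfolding openin_prod_topology_alt by meson
    obtain F where F: "finite F" "\<forall>v\<in>topspace ?P. (\<forall>i\<in>F. v i = p i) \<longrightarrow> v \<in> U"
      using open_contains_finite_coordinate_agreement[OF UV(1,3)] by blast
    obtain G where G: "finite G" "\<forall>w\<in>topspace ?Q. (\<forall>j\<in>G. w j = q j) \<longrightarrow> w \<in> V"
      using open_contains_finite_coordinate_agreement[OF UV(2,4)] by blast
    have "dist (h (p, q)) (h (v, w)) < 1 / Suc n"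
      if "v \<in> topspace ?P" "w \<in> topspace ?Q" "\<forall>i\<in>F. v i = p i" "\<forall>j\<in>G. w j = q j" for v w
    proof -
      have "(v, w) \<in> ?W"
        using that F(2) G(2) UV(5) by blast
      then show ?thesis
        by simp
    qed
    then show ?thesis
      using F(1) G(1) unfolding R_def by blast
  qed
  then obtain F G where "\<And>n. R n (F n) (G n)"
    by metis
  from this[unfolded R_def] have FG: "\<And>n. finite (F n)" "\<And>n. finite (G n)"
    "\<And>n v w. \<lbrakk>v \<in> topspace ?P; w \<in> topspace ?Q; \<forall>i\<in>F n. v i = p i; \<forall>j\<in>G n. w j = q j\<rbrakk>
       \<Longrightarrow> dist (h (p, q)) (h (v, w)) < 1 / Suc n"
    by simp_all
  have "h (v, w) = h (p, q)"
    if "v \<in> topspace ?P" "w \<in> topspace ?Q" "\<forall>i\<in>\<Union>(range F). v i = p i" "\<forall>j\<in>\<Union>(range G). w j = q j" for v w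
  proof (rule ccontr)
    assume "h (v, w) \<noteq> h (p, q)"
    then obtain n where "1 / Suc n < dist (h (p, q)) (h (v, w))"
      by (metis nat_approx_posE zero_less_dist_iff)
    moreover have "dist (h (p, q)) (h (v, w)) < 1 / Suc n"
      using that by (intro FG(3)) auto
    ultimately show False
      by simp
  qed
  moreover have "countable (\<Union>(range F))" "countable (\<Union>(range G))"
    using FG(1,2) by (auto intro: countable_finite)
  ultimately show ?thesis
    by (intro exI[of _ "\<Union>(range F)"] exI[of _ "\<Union>(range G)"]) simp
qed

section \<open>Points of small oscillation\<close>

text \<open>
  The points, inside or outside of the domain \<open>S\<close>, near which \<open>f\<close> varies by less than \<open>e\<close>.
  Presenting this set as a union of open sets makes its openness immediate.
\<close>

definition small_oscillation :: "'a::metric_space set \<Rightarrow> ('a \<Rightarrow> 'b::metric_space) \<Rightarrow> real \<Rightarrow> 'a set" where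
  "small_oscillation S f e =
     \<Union>{V. open V \<and> (\<forall>x\<in>S \<inter> V. \<forall>y\<in>S \<inter> V. dist (f x) (f y) < e)}"

lemma open_small_oscillation: "open (small_oscillation S f e)"
  unfolding small_oscillation_def by blast

lemma subset_small_oscillation:
  assumes "continuous_on S f" "e > 0"
  shows "S \<subseteq> small_oscillation S f e"
proof
  fix x assume "x \<in> S"
  then obtain d where d: "d > 0" "\<And>y. y \<in> S \<Longrightarrow> dist y x < d \<Longrightarrow> dist (f y) (f x) < e / 2"
    using assms unfolding continuous_on_iff by (metis half_gt_zero)
  have "dist (f y) (f z) < e" if "y \<in> S \<inter> ball x d" "z \<in> S \<inter> ball x d" for y z
    using that d(2)[of y] d(2)[of z] dist_triangle_half_l[of "f y" "f x" e "f z"]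
    by (auto simp: dist_commute)
  then show "x \<in> small_oscillation S f e"
    unfolding small_oscillation_def using d(1) by (intro UnionI[of "ball x d"]) auto
qed

lemma Cauchy_image_if_small_oscillation:
  assumes "X \<longlonglongrightarrow> t" "\<And>n. X n \<in> S" and t: "\<And>n. t \<in> small_oscillation S f (1 / Suc n)"
  shows "Cauchy (\<lambda>n. f (X n))"
proof (rule metric_CauchyI)
  fix e :: real assume "e > 0"
  then obtain n where n: "1 / Suc n < e"
    by (rule nat_approx_posE)
  obtain V where V: "open V" "t \<in> V" "\<And>x y. x \<in> S \<inter> V \<Longrightarrow> y \<in> S \<inter> V \<Longrightarrow> dist (f x) (f y) < 1 / Suc n"
    using t[of n] unfolding small_oscillation_def by blast
  obtain M where "\<And>m. m \<ge> M \<Longrightarrow> X m \<in> V"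
    using topological_tendstoD[OF assms(1) V(1,2)] by (auto simp: eventually_sequentially)
  then have "\<forall>m\<ge>M. \<forall>k\<ge>M. dist (f (X m)) (f (X k)) < e"
    using assms(2) V(3) n by (meson IntI less_trans)
  then show "\<exists>M. \<forall>m\<ge>M. \<forall>k\<ge>M. dist (f (X m)) (f (X k)) < e"
    by blast
qed

text \<open>
  Translations preserve open dense sets, so Baire's theorem also covers the second requirement,
  which says that \<open>t\<close> lies in the translate by \<open>- c\<close> of a set of small oscillation.
\<close>

lemma common_zero_oscillation_point:
  fixes S :: "'a::{real_normed_vector,heine_borel} set"
    and A :: "('a \<Rightarrow> 'b::metric_space) set"
  assumes S: "closure S = UNIV" and A: "countable A" "\<And>f. f \<in> A \<Longrightarrow> continuous_on S f"
  shows "\<exists>t. \<forall>f\<in>A. \<forall>n. t \<in> small_oscillation S f (1 / Suc n) \<and>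
    t + c \<in> small_oscillation S f (1 / Suc n)"
proof -
  let ?T = "\<lambda>(f, n, b). (+) (- b) ` small_oscillation S f (1 / real (Suc n))"
  have "UNIV \<subseteq> closure (\<Inter>(?T ` (A \<times> UNIV \<times> {0, c})))"
  proof (rule Baire)
    show "countable (?T ` (A \<times> UNIV \<times> {0, c}))"
      using A(1) by (intro countable_image countable_SIGMA) auto
    fix T assume "T \<in> ?T ` (A \<times> UNIV \<times> {0, c})"
    then obtain f n b where T: "f \<in> A" "T = (+) (- b) ` small_oscillation S f (1 / real (Suc n))"
      by auto
    have "closure (small_oscillation S f (1 / real (Suc n))) = UNIV"
      using closure_mono[OF subset_small_oscillation[OF A(2)[OF T(1)], of "1 / real (Suc n)"]] S
      by (simp add: top.extremum_unique)
    then have "closure T = UNIV"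
      unfolding T(2) closure_translation by simp
    moreover have "open T"
      unfolding T(2) by (intro open_translation open_small_oscillation)
    ultimately show "openin (top_of_set UNIV) T \<and> UNIV \<subseteq> closure T"
      by (simp flip: open_openin)
  qed simp
  then obtain t where t: "t \<in> \<Inter>(?T ` (A \<times> UNIV \<times> {0, c}))"
    using closure_empty by (metis UNIV_not_empty all_not_in_conv subset_empty)
  have t': "t + b \<in> small_oscillation S f (1 / Suc n)" if "f \<in> A" "b \<in> {0, c}" for f n b
  proof -
    have "t \<in> ?T (f, n, b)"
      using t that by blast
    then show ?thesis
      by (auto simp: add.commute)
  qed
  show ?thesis
    using t'[of _ 0] t'[of _ c] by (intro exI[of _ t]) simp
qed

section \<open>Rational sequences that straddle a line\<close>

lemma rational_sequence_tendsto_above: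
  "\<exists>X :: nat \<Rightarrow> real. X \<longlonglongrightarrow> s \<and> (\<forall>n. X n \<in> \<rat> \<and> s < X n)"
proof -
  have "\<forall>n. \<exists>x\<in>\<rat>. s < x \<and> x < s + 1 / Suc n"
    using Rats_dense_in_real by simp
  then obtain X where X: "\<And>n. X n \<in> \<rat>" "\<And>n. s < X n" "\<And>n. X n < s + 1 / Suc n"
    by metis
  have "(\<lambda>n. s + 1 / Suc n) \<longlonglongrightarrow> s"
    using LIMSEQ_inverse_real_of_nat_add[of s] by (simp add: inverse_eq_divide)
  then have "X \<longlonglongrightarrow> s"
    using tendsto_sandwich[of "\<lambda>_. s" X sequentially "\<lambda>n. s + 1 / Suc n" s] X(2,3)
    by (simp add: always_eventually less_imp_le del: of_nat_Suc)
  with X(1,2) show ?thesis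
    by blast
qed

text \<open>
  A single sequence that visits both sides in turn serves better than one sequence for each side:
  all that is known about a point of oscillation zero is that values along a sequence converge, and
  with one sequence there is only one limit to compare with.
\<close>

lemma rational_sequence_tendsto_alternating:
  "\<exists>X :: nat \<Rightarrow> real. X \<longlonglongrightarrow> s \<and> (\<forall>n. X n \<in> \<rat> \<and> (if even n then s < X n else X n < s))"
proof -
  obtain U where U: "U \<longlonglongrightarrow> s" "\<forall>n. U n \<in> \<rat> \<and> s < U n"
    using rational_sequence_tendsto_above[of "s"] by blast
  obtain V where V: "V \<longlonglongrightarrow> - s" "\<forall>n. V n \<in> \<rat> \<and> - s < V n"
    using rational_sequence_tendsto_above[of "- s"] by blast
  let ?X = "\<lambda>n. if even n then U n else - V n"
  have "(\<lambda>n. - V n) \<longlonglongrightarrow> s"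
    using tendsto_minus[OF V(1)] by simp
  with U(1) have lim: "?X \<longlonglongrightarrow> s"
    by (rule filterlim_If[OF filterlim_mono[OF _ order_refl inf_le1] filterlim_mono[OF _ order_refl inf_le1]])
  have "?X n \<in> \<rat> \<and> (if even n then s < ?X n else ?X n < s)" for n
    using U(2)[rule_format, of n] V(2)[rule_format, of n] by auto
  with lim show ?thesis
    by (intro exI[of _ ?X] conjI allI) fast+
qed

section \<open>The step function along an irrational line\<close>

lemma continuous_on_indicator_above:
  fixes c :: "'a::linorder_topology"
  shows "continuous_on (- {c}) (indicator {c<..} :: 'a \<Rightarrow> real)"
proof -
  have "continuous_on ({..<c} \<union> {c<..}) (indicator {c<..} :: 'a \<Rightarrow> real)"
  proof (rule continuous_on_open_Un)
    show "continuous_on {..<c} (indicator {c<..} :: 'a \<Rightarrow> real)"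
      by (rule continuous_on_eq[where f = "\<lambda>_. 0"]) auto
    show "continuous_on {c<..} (indicator {c<..} :: 'a \<Rightarrow> real)"
      by (rule continuous_on_eq[where f = "\<lambda>_. 1"]) auto
  qed auto
  moreover have "{..<c} \<union> {c<..} = - {c}"
    by auto
  ultimately show ?thesis
    by simp
qed

theorem theorem3p3:
  "\<not> Cstar_embedded
       (prod_topology (real_power_topology rational_space) (real_power_topology rational_space))
       (diagonal_embedding rational_space ` topspace rational_space \<times>
        diagonal_embedding rational_space ` topspace rational_space)"
proof
  let ?C = "continuous_real_functions rational_space"
  let ?P = "real_power_topology rational_space"
  let ?e = "diagonal_embedding rational_space"
  assume emb: "Cstar_embedded (prod_topology ?P ?P)
    (?e ` topspace rational_space \<times> ?e ` topspace rational_space)"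
  have top_P: "topspace ?P = (\<Pi>\<^sub>E f\<in>?C. UNIV)"
    by (simp add: real_power_topology_def)
  obtain c :: real where c: "c \<notin> \<rat>"
    using countable_rat uncountable_UNIV_real by (metis UNIV_eq_I)
  \<comment> \<open>The coordinate at \<open>\<iota>\<close> recovers \<open>x\<close> from \<open>e x\<close>, which lets \<open>g\<close> be written on the power itself.\<close>
  define \<iota> :: "real \<Rightarrow> real" where "\<iota> = restrict id \<rat>"
  have \<iota>: "\<iota> \<in> ?C"
    by (auto simp: \<iota>_def continuous_real_functions_def)
  have e_\<iota>: "?e x \<iota> = x" if "x \<in> \<rat>" for x
    using that \<iota> by (simp add: diagonal_embedding_def \<iota>_def)
  define g :: "((real \<Rightarrow> real) \<Rightarrow> real) \<times> ((real \<Rightarrow> real) \<Rightarrow> real) \<Rightarrow> real"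
    where "g z = indicator {c<..} (snd z \<iota> - fst z \<iota>)" for z
  have g_e: "g (?e x, ?e y) = indicator {c<..} (y - x)" if "x \<in> \<rat>" "y \<in> \<rat>" for x y
    using that by (simp add: g_def e_\<iota>)
  have "continuous_map ?P euclideanreal (\<lambda>v. v \<iota>)"
    unfolding real_power_topology_def using continuous_map_product_projection[OF \<iota>] .
  from continuous_map_compose[OF continuous_map_fst this]
    continuous_map_compose[OF continuous_map_snd this]
  have diff: "continuous_map (prod_topology ?P ?P) euclideanreal (\<lambda>z. snd z \<iota> - fst z \<iota>)"
    by (intro continuous_map_diff) (simp_all add: o_def)
  have "snd z \<iota> - fst z \<iota> \<noteq> c" if "z \<in> ?e ` \<rat> \<times> ?e ` \<rat>" for z
    using that c by (auto simp: e_\<iota>)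
  then have diff': "continuous_map (subtopology (prod_topology ?P ?P) (?e ` \<rat> \<times> ?e ` \<rat>))
      (top_of_set (- {c})) (\<lambda>z. snd z \<iota> - fst z \<iota>)"
    unfolding continuous_map_in_subtopology
    using continuous_map_from_subtopology[OF diff] by (simp add: image_subset_iff)
  have "continuous_map (top_of_set (- {c})) euclideanreal (indicator {c<..})"
    using continuous_on_indicator_above[of c] by simp
  from continuous_map_compose[OF diff' this]
  have g: "continuous_map (subtopology (prod_topology ?P ?P) (?e ` \<rat> \<times> ?e ` \<rat>)) euclideanreal g"
    by (simp add: g_def[abs_def] o_def)
  have "bounded (g ` (?e ` \<rat> \<times> ?e ` \<rat>))"
    by (rule boundedI[of _ 1]) (auto simp: g_def indicator_def)
  with g obtain h where h: "continuous_map (prod_topology ?P ?P) euclideanreal h"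
      and h_e: "\<And>x y. x \<in> \<rat> \<Longrightarrow> y \<in> \<rat> \<Longrightarrow> h (?e x, ?e y) = indicator {c<..} (y - x)"
    using emb[unfolded Cstar_embedded_def, rule_format, of g] g_e by auto
  have e_top: "?e x \<in> topspace ?P" for x
    by (simp add: top_P diagonal_embedding_def)
  define R where "R x y D \<longleftrightarrow> countable D \<and> (\<forall>v\<in>topspace ?P. \<forall>w\<in>topspace ?P.
      (\<forall>f\<in>D. v f = ?e x f) \<longrightarrow> (\<forall>f\<in>D. w f = ?e y f) \<longrightarrow> h (v, w) = h (?e x, ?e y))" for x y D
  have "\<exists>D. R x y D" for x y
  proof -
    obtain A B where "countable A" "countable B"
      and "\<forall>v\<in>topspace ?P. \<forall>w\<in>topspace ?P.
        (\<forall>f\<in>A. v f = ?e x f) \<longrightarrow> (\<forall>f\<in>B. w f = ?e y f) \<longrightarrow> h (v, w) = h (?e x, ?e y)"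
      using continuous_map_countably_determined_at[OF h[unfolded real_power_topology_def]
          e_top[of x, unfolded real_power_topology_def] e_top[of y, unfolded real_power_topology_def]]
      unfolding real_power_topology_def by blast
    then have "R x y (A \<union> B)"
      by (simp add: R_def)
    then show ?thesis ..
  qed
  then obtain D where "\<And>x y. R x y (D x y)"
    by metis
  from this[unfolded R_def] have D: "\<And>x y. countable (D x y)"
    "\<And>x y v w. \<lbrakk>v \<in> topspace ?P; w \<in> topspace ?P; \<forall>f\<in>D x y. v f = ?e x f; \<forall>f\<in>D x y. w f = ?e y f\<rbrakk>
       \<Longrightarrow> h (v, w) = h (?e x, ?e y)"
    by simp_all
  \<comment> \<open>Elements of the power have no meaningful values outside the index set, so the members of
    \<open>D x y\<close> that are not continuous functions on the rationals can be dropped.\<close>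
  define A where "A = (\<Union>x\<in>\<rat>. \<Union>y\<in>\<rat>. D x y) \<inter> ?C"
  have "countable A"
    unfolding A_def by (intro countable_Int1 countable_UN countable_rat D(1))
  moreover have "continuous_on \<rat> f" if "f \<in> A" for f
    using that by (auto simp: A_def continuous_real_functions_def)
  ultimately obtain t where t_tc: "\<forall>f\<in>A. \<forall>n. t \<in> small_oscillation \<rat> f (1 / Suc n) \<and>
      t + c \<in> small_oscillation \<rat> f (1 / Suc n)"
    using common_zero_oscillation_point[OF Rats_closure_real, of A c] by blast
  have t: "t \<in> small_oscillation \<rat> f (1 / Suc n)"
    and tc: "t + c \<in> small_oscillation \<rat> f (1 / Suc n)" if "f \<in> A" for f n
    using t_tc that by blast+
  define r where "r x = (\<lambda>f\<in>?C. if f \<in> A then f x else 0)" for x :: real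
  have r_top: "r x \<in> topspace ?P" for x
    by (simp add: top_P r_def)
  have r_e: "r z f = ?e z f" if "x \<in> \<rat>" "y \<in> \<rat>" "f \<in> D x y" for x y z f
    using that by (auto simp: r_def A_def diagonal_embedding_def)
  have h_r: "h (r x, r y) = indicator {c<..} (y - x)" if "x \<in> \<rat>" "y \<in> \<rat>" for x y
    using D(2)[OF r_top r_top, of x y x y] r_e[OF that] h_e[OF that] by simp
  have r_lim: "\<exists>p. limitin ?P (\<lambda>n. r (X n)) p sequentially"
    if X: "X \<longlonglongrightarrow> s" "\<And>n. X n \<in> \<rat>" and s: "\<And>f n. f \<in> A \<Longrightarrow> s \<in> small_oscillation \<rat> f (1 / Suc n)" for X s
  proof -
    have "\<exists>l. (\<lambda>n. r (X n) f) \<longlonglongrightarrow> l" if "f \<in> ?C" for f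
    proof (cases "f \<in> A")
      case True
      then have "convergent (\<lambda>n. f (X n))"
        using Cauchy_image_if_small_oscillation[OF X s] by (simp add: Cauchy_convergent_iff)
      then show ?thesis
        using True that by (simp add: r_def convergent_def)
    qed (use that in \<open>auto simp: r_def\<close>)
    then have "\<exists>l. \<forall>f\<in>?C. (\<lambda>n. r (X n) f) \<longlonglongrightarrow> l f"
      by (intro bchoice) simp
    then obtain l where "\<forall>f\<in>?C. (\<lambda>n. r (X n) f) \<longlonglongrightarrow> l f" ..
    then have "limitin ?P (\<lambda>n. r (X n)) (restrict l ?C) sequentially"
      using r_top unfolding real_power_topology_def by (simp add: limitin_componentwise)
    then show ?thesis
      by blast
  qed
  obtain X where X: "X \<longlonglongrightarrow> - t" "\<forall>n. X n \<in> \<rat> \<and> (if even n then - t < X n else X n < - t)"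
    using rational_sequence_tendsto_alternating[of "- t"] by blast
  obtain Y where Y: "Y \<longlonglongrightarrow> t + c" "\<forall>n. Y n \<in> \<rat> \<and> (if even n then t + c < Y n else Y n < t + c)"
    using rational_sequence_tendsto_alternating[of "t + c"] by blast
  have X_rat: "- X n \<in> \<rat>" and Y_rat: "Y n \<in> \<rat>" for n
    using X(2) Y(2) by simp_all
  \<comment> \<open>\<open>- X n\<close> lies below \<open>t\<close> exactly when \<open>Y n\<close> lies above \<open>t + c\<close>, so the two deviations add up.\<close>
  have h_XY: "h (r (- X n), r (Y n)) = (if even n then 1 else 0)" for n
    using X(2)[rule_format, of n] Y(2)[rule_format, of n] h_r[OF X_rat Y_rat, of n n]
    by (cases "even n") (simp_all add: indicator_def)
  have "(\<lambda>n. - X n) \<longlonglongrightarrow> t"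
    using tendsto_minus[OF X(1)] by simp
  from r_lim[OF this X_rat t] obtain p where p: "limitin ?P (\<lambda>n. r (- X n)) p sequentially"
    by blast
  from r_lim[OF Y(1) Y_rat tc] obtain q where q: "limitin ?P (\<lambda>n. r (Y n)) q sequentially"
    by blast
  have "limitin (prod_topology ?P ?P) (\<lambda>n. (r (- X n), r (Y n))) (p, q) sequentially"
    using p q by (simp add: limitin_pairwise o_def)
  from continuous_map_limit[OF h this]
  have lim: "(\<lambda>n. if even n then 1 else 0 :: real) \<longlonglongrightarrow> h (p, q)"
    by (simp add: o_def h_XY)
  have "(\<lambda>n. 1 :: real) \<longlonglongrightarrow> h (p, q)"
    using LIMSEQ_subseq_LIMSEQ[OF lim, of "\<lambda>n. 2 * n"] by (simp add: strict_mono_def o_def)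
  moreover have "(\<lambda>n. 0 :: real) \<longlonglongrightarrow> h (p, q)"
    using LIMSEQ_subseq_LIMSEQ[OF lim, of "\<lambda>n. 2 * n + 1"] by (simp add: strict_mono_def o_def)
  ultimately show False
    by (simp add: LIMSEQ_const_iff)
qed

end
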